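(* $\mathrm{Rs}(K_3\cup K_1)=22$.
   Context: All graphs are finite and simple. $K_3\cup K_1$ is the triangle plus one isolated vertex. A (not necessarily induced) subgraph $H$ of a host graph $F$ is singular if the degrees $d_F(v)$, $v\in V(H)$, taken in $F$, are all equal or pairwise distinct (isolated vertices of $H$ count as vertices). In an edge 2-coloring of $K_m$, the host graph of a color is the spanning graph on all $m$ vertices formed by the edges of that color. The singular Ramsey number $\mathrm{Rs}(G)$ is the smallest integer $N$ such that for every $m\ge N$ and every 2-coloring of the edges of $K_m$, at least one of the two color graphs contains a singular subgraph isomorphic to $G$. *)

theory Defs
  imports "HOL-Library.Ramsey"
begin

(* nsets V 2, written [V]\<^bsup>2\<^esup>, is the set of two-element subsets of V. *)

record 'a graph =
  verts :: "'a set"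
  edges :: "'a set set"

definition simple_graph :: "'a graph \<Rightarrow> bool" where
  "simple_graph G \<longleftrightarrow> finite (verts G) \<and> edges G \<subseteq> [verts G]\<^bsup>2\<^esup>"

definition degree :: "'a graph \<Rightarrow> 'a \<Rightarrow> nat" where
  "degree G v = card {e \<in> edges G. v \<in> e}"

definition subgraph :: "'a graph \<Rightarrow> 'a graph \<Rightarrow> bool" where
  "subgraph H F \<longleftrightarrow>
     simple_graph H \<and> simple_graph F \<and> verts H \<subseteq> verts F \<and> edges H \<subseteq> edges F"

definition isomorphic :: "'a graph \<Rightarrow> 'b graph \<Rightarrow> bool" where
  "isomorphic G H \<longleftrightarrow>
     (\<exists>f. bij_betw f (verts G) (verts H) \<and>
       (\<forall>u\<in>verts G. \<forall>v\<in>verts G. {u, v} \<in> edges G \<longleftrightarrow> {f u, f v} \<in> edges H))"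

definition complete_graph :: "nat \<Rightarrow> nat graph" where
  "complete_graph m = \<lparr>verts = {..<m}, edges = [{..<m}]\<^bsup>2\<^esup>\<rparr>"

definition disjoint_union :: "'a graph \<Rightarrow> 'b graph \<Rightarrow> ('a + 'b) graph" where
  "disjoint_union G H =
     \<lparr>verts = verts G <+> verts H,
      edges = (\<lambda>e. Inl ` e) ` edges G \<union> (\<lambda>e. Inr ` e) ` edges H\<rparr>"

(* The degrees are those in the host graph F, not those in H. *)
definition singular_subgraph :: "'a graph \<Rightarrow> 'a graph \<Rightarrow> bool" where
  "singular_subgraph H F \<longleftrightarrow>
     subgraph H F \<and>
     ((\<forall>u\<in>verts H. \<forall>v\<in>verts H. degree F u = degree F v) \<or>
      inj_on (degree F) (verts H))"

(* A 2-coloring of the edges of K is any c :: 'a set \<Rightarrow> bool; only its values on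
   edges K are ever used. *)
definition color_graph :: "'a graph \<Rightarrow> ('a set \<Rightarrow> bool) \<Rightarrow> bool \<Rightarrow> 'a graph" where
  "color_graph K c i = \<lparr>verts = verts K, edges = {e \<in> edges K. c e = i}\<rparr>"

(* LEAST carries no information if no N qualifies, so proving Rs G = n includes
   proving that some N does. *)
definition Rs :: "'a graph \<Rightarrow> nat" where
  "Rs G = (LEAST N. \<forall>m\<ge>N. \<forall>c. \<exists>i H.
     singular_subgraph H (color_graph (complete_graph m) c i) \<and> isomorphic G H)"

end

theory Submission
  imports Defs
begin

text \<open>
  The degrees of a vertex in the two color graphs of \<open>K\<^sub>m\<close> add up to \<open>m - 1\<close>, so both colors induce
  the same partition of the vertices into degree classes. Suppose that there is no singular
  \<open>K\<^sub>3 \<union> K\<^sub>1\<close>. A degree class with at least four vertices contains no monochromatic triangle, because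
  any other vertex of the class would complete one to a singular copy. Since the Ramsey number
  \<open>R(3,3)\<close> is 6, each class has at most 5 vertices. Likewise, if there are at least four classes, a
  transversal of the classes contains no monochromatic triangle, so there are at most 5 classes.

  Let \<open>m \<ge> 22\<close>. Then there are exactly 5 classes. A 2-coloring of \<open>K\<^sub>5\<close> without a monochromatic
  triangle is a red pentagon with a blue pentagram; in particular every vertex of a transversal has
  exactly two red neighbors in it, and this remains so when one representative is exchanged for
  another one of its class. Hence all edges between a vertex and a class other than its own have the
  same color (\<open>color_constant_on_class\<close>), and the coloring is a blow-up of the pentagon. So the red
  degree \<open>d\<^sub>i\<close> belonging to a class of size \<open>n\<^sub>i\<close> is the sum of the sizes of the two classes that are
  red neighbors, plus the red degree \<open>r\<^sub>i\<close> inside the class, where \<open>n\<^sub>i - 3 \<le> r\<^sub>i \<le> 2\<close>. The upper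
  bound yields \<open>d\<^sub>i \<le> 5 + 5 + 2 = 12\<close>, and as the five degrees are distinct, their sum is at most
  \<open>12 + 11 + 10 + 9 + 8 = 50\<close>. The lower bound, summed over all classes, yields a sum of at least
  \<open>2 m + (m - 15) \<ge> 51\<close>. This contradiction is \<open>card_le_21\<close>.

  The count also shows how to color \<open>K\<^sub>2\<^sub>1\<close>: blow up the pentagon with classes of sizes 5, 5, 5, 2, 4
  in cyclic order, put a pentagon into each class of size 5, a red edge into the class of size 2 and
  a red perfect matching into the class of size 4. The red degrees are then 11, 12, 9, 10, 8, one for
  each class, and neither a transversal nor a class contains a monochromatic triangle
  (\<open>not_has_singular_blowup\<close>).
\<close>

section \<open>Singular configurations of a coloring\<close>

text \<open>
  A coloring is a relation that holds for the red pairs. Its values on the diagonal are arbitrary,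
  which is why neighborhoods exclude the vertex itself.
\<close>

definition mono_triangle :: "('a \<Rightarrow> 'a \<Rightarrow> bool) \<Rightarrow> 'a \<Rightarrow> 'a \<Rightarrow> 'a \<Rightarrow> bool" where
  "mono_triangle r x y z \<longleftrightarrow>
     x \<noteq> y \<and> y \<noteq> z \<and> x \<noteq> z \<and> (\<exists>i. r x y = i \<and> r y z = i \<and> r x z = i)"

definition red_nbrs :: "'a set \<Rightarrow> ('a \<Rightarrow> 'a \<Rightarrow> bool) \<Rightarrow> 'a \<Rightarrow> 'a set" where
  "red_nbrs S r v = {u \<in> S. u \<noteq> v \<and> r v u}"

definition red_degree :: "'a set \<Rightarrow> ('a \<Rightarrow> 'a \<Rightarrow> bool) \<Rightarrow> 'a \<Rightarrow> nat" where
  "red_degree S r v = card (red_nbrs S r v)"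

definition const_or_inj_on :: "('a \<Rightarrow> 'b) \<Rightarrow> 'a set \<Rightarrow> bool" where
  "const_or_inj_on f X \<longleftrightarrow> (\<forall>u\<in>X. \<forall>v\<in>X. f u = f v) \<or> inj_on f X"

text \<open>
  The vertices \<open>x\<close>, \<open>y\<close>, \<open>z\<close> carry the triangle and \<open>w\<close> is the isolated vertex. Red degrees suffice,
  also for blue triangles, since the blue degree is a constant minus the red one.
\<close>

definition has_singular :: "'a set \<Rightarrow> ('a \<Rightarrow> 'a \<Rightarrow> bool) \<Rightarrow> bool" where
  "has_singular V r \<longleftrightarrow>
     (\<exists>x\<in>V. \<exists>y\<in>V. \<exists>z\<in>V. \<exists>w\<in>V. mono_triangle r x y z \<and> w \<notin> {x, y, z} \<and>
        const_or_inj_on (red_degree V r) {x, y, z, w})"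

lemma const_or_inj_on_cong:
  assumes "\<And>u v. u \<in> X \<Longrightarrow> v \<in> X \<Longrightarrow> f u = f v \<longleftrightarrow> g u = g v"
  shows "const_or_inj_on f X \<longleftrightarrow> const_or_inj_on g X"
  using assms unfolding const_or_inj_on_def inj_on_def by simp

section \<open>From graphs to colored vertex sets\<close>

lemma nsets_2_iff: "e \<in> [A]\<^bsup>2\<^esup> \<longleftrightarrow> (\<exists>x y. x \<in> A \<and> y \<in> A \<and> x \<noteq> y \<and> e = {x, y})"
  by (auto simp: nsets_def card_2_iff)

lemma nsets_2_insert: "[insert a A]\<^bsup>2\<^esup> = (\<lambda>b. {a, b}) ` (A - {a}) \<union> [A]\<^bsup>2\<^esup>"
  unfolding nsets_2_eq by (auto simp: insert_commute)

lemma nsets_2_empty: "[{}]\<^bsup>2\<^esup> = {}"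
  by (simp add: nsets_2_eq)

text \<open>Edges at \<open>v\<close> correspond to neighbors of \<open>v\<close> via \<open>u \<mapsto> {v, u}\<close>.\<close>

lemma degree_eq_card_nbrs:
  assumes "simple_graph G"
  shows "degree G v = card {u. {v, u} \<in> edges G}"
proof -
  have "{e \<in> edges G. v \<in> e} \<subseteq> (\<lambda>u. {v, u}) ` {u. {v, u} \<in> edges G}"
  proof
    fix e assume e: "e \<in> {e \<in> edges G. v \<in> e}"
    then have "e \<in> [verts G]\<^bsup>2\<^esup>"
      using assms by (auto simp: simple_graph_def)
    then obtain x y where "e = {x, y}"
      unfolding nsets_2_iff by blast
    then obtain u where "e = {v, u}"
      using e by blast
    then show "e \<in> (\<lambda>u. {v, u}) ` {u. {v, u} \<in> edges G}"
      using e by blast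
  qed
  moreover have "inj_on (\<lambda>u. {v, u}) {u. {v, u} \<in> edges G}"
    by (rule inj_onI) (auto simp: doubleton_eq_iff)
  ultimately have "bij_betw (\<lambda>u. {v, u}) {u. {v, u} \<in> edges G} {e \<in> edges G. v \<in> e}"
    by (auto simp: bij_betw_def)
  then have "card {u. {v, u} \<in> edges G} = card {e \<in> edges G. v \<in> e}"
    by (rule bij_betw_same_card)
  then show ?thesis
    by (simp add: degree_def)
qed

lemma simple_color_graph: "simple_graph (color_graph (complete_graph m) c i)"
  by (auto simp: simple_graph_def color_graph_def complete_graph_def)

lemma degree_color_graph_True:
  assumes "v < m"
  shows "degree (color_graph (complete_graph m) c True) v =
    red_degree {..<m} (\<lambda>u v. c {u, v}) v"
proof -
  have "{u. {v, u} \<in> edges (color_graph (complete_graph m) c True)} =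
    red_nbrs {..<m} (\<lambda>u v. c {u, v}) v"
    using assms
    by (auto simp: color_graph_def complete_graph_def red_nbrs_def)
  then show ?thesis
    by (simp add: degree_eq_card_nbrs[OF simple_color_graph] red_degree_def)
qed

lemma degree_color_graph_complement:
  assumes "v < m"
  shows "degree (color_graph (complete_graph m) c False) v +
    degree (color_graph (complete_graph m) c True) v = m - 1"
proof -
  let ?N = "\<lambda>i. {u. {v, u} \<in> edges (color_graph (complete_graph m) c i)}"
  have fin: "finite (?N i)" for i
    by (rule finite_subset[of _ "{..<m}"]) (auto simp: color_graph_def complete_graph_def)
  have "card (?N False \<union> ?N True) = card (?N False) + card (?N True)"
  proof (intro card_Un_disjoint fin)
    show "?N False \<inter> ?N True = {}"
      by (auto simp: color_graph_def)
  qed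
  moreover have "?N False \<union> ?N True = {..<m} - {v}"
    using assms by (auto simp: color_graph_def complete_graph_def)
  ultimately show ?thesis
    using assms by (simp add: degree_eq_card_nbrs[OF simple_color_graph])
qed

text \<open>
  The two degrees of a vertex determine each other, so either color may be used to test whether
  degrees agree.
\<close>

lemma degree_color_graph_eq_iff:
  assumes "u < m" "v < m"
  shows "degree (color_graph (complete_graph m) c i) u =
      degree (color_graph (complete_graph m) c i) v \<longleftrightarrow>
    red_degree {..<m} (\<lambda>u v. c {u, v}) u = red_degree {..<m} (\<lambda>u v. c {u, v}) v"
proof (cases i)
  case True
  then show ?thesis
    using assms by (simp add: degree_color_graph_True)
next
  case False
  have "i = False"
    using False by simp
  show ?thesis
    using degree_color_graph_complement[OF assms(1), of c]
      degree_color_graph_complement[OF assms(2), of c]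
    unfolding \<open>i = False\<close> degree_color_graph_True[OF assms(1)] degree_color_graph_True[OF assms(2)]
    by linarith
qed

lemma lessThan_3: "{..<3} = {0, 1, 2::nat}"
  by auto

lemma verts_K3_K1:
  "verts (disjoint_union (complete_graph 3) (complete_graph 1)) =
     {Inl 0, Inl 1, Inl 2, Inr 0}"
  by (simp add: disjoint_union_def complete_graph_def lessThan_3 lessThan_Suc Plus_def insert_commute)

lemma edges_K3_K1:
  "edges (disjoint_union (complete_graph 3) (complete_graph 1)) =
     {{Inl 0, Inl 1}, {Inl 1, Inl 2}, {Inl 0, Inl 2}}"
proof -
  have "[{..<3::nat}]\<^bsup>2\<^esup> = {{0, 1}, {1, 2}, {0, 2}}"
    by (simp add: lessThan_3 nsets_2_insert nsets_2_empty insert_commute)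
  moreover have "[{..<1::nat}]\<^bsup>2\<^esup> = {}"
    by (simp add: lessThan_Suc nsets_2_insert nsets_2_empty)
  ultimately show ?thesis
    by (simp add: disjoint_union_def complete_graph_def)
qed

lemma isomorphic_K3_K1_I:
  assumes "distinct [x, y, z, w]"
  shows "isomorphic (disjoint_union (complete_graph 3) (complete_graph 1))
    \<lparr>verts = {x, y, z, w}, edges = {{x, y}, {y, z}, {x, z}}\<rparr>"
proof -
  let ?f = "case_sum (\<lambda>k. if k = 0 then x else if k = 1 then y else z) (\<lambda>_. w)
    :: nat + nat \<Rightarrow> _"
  have "bij_betw ?f {Inl 0, Inl 1, Inl 2, Inr 0} {x, y, z, w}"
    using assms by (auto simp: bij_betw_def inj_on_def)
  then show ?thesis
    unfolding isomorphic_def verts_K3_K1 edges_K3_K1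
    using assms by (intro exI[of _ ?f]) (auto simp: doubleton_eq_iff)
qed

lemma isomorphic_K3_K1_D:
  assumes "isomorphic (disjoint_union (complete_graph 3) (complete_graph 1)) H"
  obtains x y z w where "distinct [x, y, z, w]" "verts H = {x, y, z, w}"
    "{{x, y}, {y, z}, {x, z}} \<subseteq> edges H"
proof -
  obtain f where f: "bij_betw f {Inl (0::nat), Inl 1, Inl 2, Inr (0::nat)} (verts H)"
    and e: "\<forall>u\<in>{Inl (0::nat), Inl 1, Inl 2, Inr (0::nat)}. \<forall>v\<in>{Inl 0, Inl 1, Inl 2, Inr 0}.
      {u, v} \<in> {{Inl 0, Inl 1}, {Inl 1, Inl 2}, {Inl 0, Inl 2}} \<longleftrightarrow> {f u, f v} \<in> edges H"
    using assms unfolding isomorphic_def verts_K3_K1 edges_K3_K1 by (elim exE conjE)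
  show ?thesis
  proof (rule that)
    show "distinct [f (Inl 0), f (Inl 1), f (Inl 2), f (Inr 0)]"
      using f by (auto simp: bij_betw_def inj_on_def)
    show "verts H = {f (Inl 0), f (Inl 1), f (Inl 2), f (Inr 0)}"
      using f by (auto simp: bij_betw_def)
    show "{{f (Inl 0), f (Inl 1)}, {f (Inl 1), f (Inl 2)}, {f (Inl 0), f (Inl 2)}} \<subseteq> edges H"
      using e[rule_format, of "Inl 0" "Inl 1"] e[rule_format, of "Inl 1" "Inl 2"]
        e[rule_format, of "Inl 0" "Inl 2"] by simp
  qed
qed

text \<open>
  This removes the graphs from the problem: since subgraphs need not be induced, a copy of
  \<open>K\<^sub>3 \<union> K\<^sub>1\<close> amounts to a triangle of the color graph and one more vertex.
\<close>

lemma singular_K3_K1_iff_has_singular: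
  "(\<exists>i H. singular_subgraph H (color_graph (complete_graph m) c i) \<and>
      isomorphic (disjoint_union (complete_graph 3) (complete_graph 1)) H) \<longleftrightarrow>
   has_singular {..<m} (\<lambda>u v. c {u, v})"
  (is "?graph \<longleftrightarrow> has_singular _ ?r")
proof
  assume ?graph
  then obtain i H where H: "singular_subgraph H (color_graph (complete_graph m) c i)"
    and iso: "isomorphic (disjoint_union (complete_graph 3) (complete_graph 1)) H"
    by blast
  from iso obtain x y z w where d: "distinct [x, y, z, w]" and V: "verts H = {x, y, z, w}"
    and E: "{{x, y}, {y, z}, {x, z}} \<subseteq> edges H"
    by (rule isomorphic_K3_K1_D)
  have sub: "verts H \<subseteq> {..<m}" "edges H \<subseteq> {e. c e = i}"
    using H by (auto simp: singular_subgraph_def subgraph_def color_graph_def complete_graph_def)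
  have "const_or_inj_on (degree (color_graph (complete_graph m) c i)) {x, y, z, w}"
    using H V by (simp add: singular_subgraph_def const_or_inj_on_def)
  moreover have "const_or_inj_on (degree (color_graph (complete_graph m) c i)) {x, y, z, w} \<longleftrightarrow>
      const_or_inj_on (red_degree {..<m} ?r) {x, y, z, w}"
    using sub(1) V by (intro const_or_inj_on_cong degree_color_graph_eq_iff) auto
  moreover have "mono_triangle ?r x y z" "w \<notin> {x, y, z}"
    using d E sub(2) by (auto simp: mono_triangle_def)
  moreover have "x \<in> {..<m}" "y \<in> {..<m}" "z \<in> {..<m}" "w \<in> {..<m}"
    using sub(1) V by auto
  ultimately show "has_singular {..<m} ?r"
    unfolding has_singular_def by blast
next
  assume "has_singular {..<m} ?r"
  then obtain x y z w where lt: "x < m" "y < m" "z < m" "w < m"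
    and t: "mono_triangle ?r x y z" and w: "w \<notin> {x, y, z}"
    and deg: "const_or_inj_on (red_degree {..<m} ?r) {x, y, z, w}"
    unfolding has_singular_def by blast
  from t obtain i where i: "c {x, y} = i" "c {y, z} = i" "c {x, z} = i"
    unfolding mono_triangle_def by blast
  let ?H = "\<lparr>verts = {x, y, z, w}, edges = {{x, y}, {y, z}, {x, z}}\<rparr>"
  let ?F = "color_graph (complete_graph m) c i"
  have dist: "distinct [x, y, z, w]"
    using t w by (auto simp: mono_triangle_def)
  have "subgraph ?H ?F"
    using lt i dist simple_color_graph[of m c i]
    by (auto simp: subgraph_def simple_graph_def color_graph_def complete_graph_def)
  moreover have "const_or_inj_on (degree ?F) {x, y, z, w} \<longleftrightarrow>
      const_or_inj_on (red_degree {..<m} ?r) {x, y, z, w}"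
    using lt by (intro const_or_inj_on_cong degree_color_graph_eq_iff) auto
  ultimately have "singular_subgraph ?H ?F"
    using deg by (simp add: singular_subgraph_def const_or_inj_on_def)
  then show ?graph
    using isomorphic_K3_K1_I[OF dist] by blast
qed

section \<open>Colorings without monochromatic triangles\<close>

definition triangle_free_on :: "'a set \<Rightarrow> ('a \<Rightarrow> 'a \<Rightarrow> bool) \<Rightarrow> bool" where
  "triangle_free_on S r \<longleftrightarrow> (\<forall>x\<in>S. \<forall>y\<in>S. \<forall>z\<in>S. \<not> mono_triangle r x y z)"

text \<open>
  The classical argument for \<open>R(3,3) \<le> 6\<close>: among three neighbors of \<open>v\<close> in one color, either two are
  joined in that color and form a triangle with \<open>v\<close>, or all three are joined in the other color.
\<close>

lemma triangle_free_on_nbrs_le_2: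
  assumes "triangle_free_on S r" "v \<in> S"
  shows "card {u \<in> S. u \<noteq> v \<and> r v u = i} \<le> 2"
proof (rule ccontr)
  assume "\<not> ?thesis"
  then have "3 \<le> card {u \<in> S. u \<noteq> v \<and> r v u = i}"
    by simp
  then obtain T where T: "T \<subseteq> {u \<in> S. u \<noteq> v \<and> r v u = i}" "card T = 3"
    by (meson obtain_subset_with_card_n)
  then obtain x y z where xyz: "T = {x, y, z}" "x \<noteq> y" "y \<noteq> z" "x \<noteq> z"
    by (auto simp: card_3_iff)
  have "mono_triangle r v x y \<or> mono_triangle r v y z \<or> mono_triangle r v x z \<or>
      mono_triangle r x y z"
    using T xyz unfolding mono_triangle_def by (auto)
  then show False
    using assms T xyz unfolding triangle_free_on_def by auto
qed

lemma red_degree_plus_blue_degree: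
  assumes "finite S" "v \<in> S"
  shows "red_degree S r v + card {u \<in> S. u \<noteq> v \<and> r v u = False} = card S - 1"
proof -
  have "card (red_nbrs S r v \<union> {u \<in> S. u \<noteq> v \<and> r v u = False}) =
      red_degree S r v + card {u \<in> S. u \<noteq> v \<and> r v u = False}"
    unfolding red_degree_def using assms by (intro card_Un_disjoint) (auto simp: red_nbrs_def)
  moreover have "red_nbrs S r v \<union> {u \<in> S. u \<noteq> v \<and> r v u = False} = S - {v}"
    by (auto simp: red_nbrs_def)
  ultimately show ?thesis
    using assms by simp
qed

text \<open>
  The second bound says that there are at most two blue neighbors. On five vertices both bounds are
  attained, so the red graph is 2-regular.
\<close>

lemma triangle_free_on_red_degree:
  assumes "finite S" "triangle_free_on S r" "v \<in> S"
  shows "red_degree S r v \<le> 2" "card S \<le> red_degree S r v + 3"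
proof -
  show "red_degree S r v \<le> 2"
    using triangle_free_on_nbrs_le_2[OF assms(2,3), of True]
    by (simp add: red_degree_def red_nbrs_def)
  show "card S \<le> red_degree S r v + 3"
    using triangle_free_on_nbrs_le_2[OF assms(2,3), of False]
      red_degree_plus_blue_degree[OF assms(1,3), of r] by simp
qed

lemma triangle_free_on_card_le_5:
  assumes "finite S" "triangle_free_on S r"
  shows "card S \<le> 5"
proof (cases "S = {}")
  case False
  then obtain v where "v \<in> S"
    by blast
  then show ?thesis
    using triangle_free_on_red_degree[OF assms, of v] by simp
qed simp

section \<open>Singular-free colorings have at most 21 vertices\<close>

text \<open>
  The values \<open>12 - a\<close> are five distinct natural numbers, so their sum is at least
  \<open>0 + 1 + 2 + 3 + 4 = 10\<close>.
\<close>

lemma sum_distinct_nat_le: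
  fixes A :: "nat set"
  assumes "card A = 5" "\<And>a. a \<in> A \<Longrightarrow> a \<le> 12"
  shows "\<Sum> A \<le> 50"
proof -
  have fin: "finite A"
    using assms(1) card.infinite by fastforce
  have inj: "inj_on (\<lambda>a. 12 - a) A"
    using assms(2) by (auto simp: inj_on_def) (metis diff_diff_cancel)
  have "10 = \<Sum> {0..<card ((\<lambda>a. 12 - a) ` A)}"
    unfolding card_image[OF inj] assms(1) by (simp add: atLeast0LessThan lessThan_nat_numeral lessThan_Suc)
  also have "\<dots> \<le> \<Sum> ((\<lambda>a. 12 - a) ` A)"
    using fin by (intro card_sum_le_nat_sum)
  also have "\<dots> = (\<Sum>a\<in>A. 12 - a)"
    using inj by (simp add: sum.reindex)
  finally have "10 + \<Sum> A \<le> (\<Sum>a\<in>A. (12 - a) + a)"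
    by (simp add: sum.distrib)
  also have "\<dots> = (\<Sum>a\<in>A. 12)"
    using assms(2) by (intro sum.cong) auto
  finally show ?thesis
    using assms(1) by simp
qed

lemma obtain_fourth:
  assumes "4 \<le> card S"
  obtains w where "w \<in> S" "w \<notin> {x, y, z}"
proof -
  have "\<not> S \<subseteq> {x, y, z}"
  proof
    assume "S \<subseteq> {x, y, z}"
    then have "card S \<le> card {x, y, z}"
      by (intro card_mono) auto
    also have "\<dots> \<le> 3"
      by (simp add: card_insert_if)
    finally show False
      using assms by simp
  qed
  then show ?thesis
    using that by blast
qed

locale singular_free_coloring =
  fixes V :: "'a set" and r :: "'a \<Rightarrow> 'a \<Rightarrow> bool"
  assumes finite_V: "finite V"
    and sym_r: "r u v = r v u"
    and singular_free: "\<not> has_singular V r"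
begin

abbreviation deg :: "'a \<Rightarrow> nat" where
  "deg \<equiv> red_degree V r"

lemma not_const_or_inj_on_deg:
  assumes "{x, y, z, w} \<subseteq> V" "mono_triangle r x y z" "w \<notin> {x, y, z}"
  shows "\<not> const_or_inj_on deg {x, y, z, w}"
  using assms singular_free unfolding has_singular_def by auto

definition deg_class :: "'a \<Rightarrow> 'a set" where
  "deg_class s = {v \<in> V. deg v = deg s}"

lemma finite_deg_class: "finite (deg_class s)"
  unfolding deg_class_def using finite_V by simp

lemma large_class_triangle_free:
  assumes "4 \<le> card (deg_class s)"
  shows "triangle_free_on (deg_class s) r"
  unfolding triangle_free_on_def
proof (intro ballI notI)
  fix x y z
  assume xyz: "x \<in> deg_class s" "y \<in> deg_class s" "z \<in> deg_class s" "mono_triangle r x y z"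
  obtain w where w: "w \<in> deg_class s" "w \<notin> {x, y, z}"
    using obtain_fourth[OF assms] .
  then have "const_or_inj_on deg {x, y, z, w}" "{x, y, z, w} \<subseteq> V"
    using xyz unfolding const_or_inj_on_def deg_class_def by auto
  then show False
    using not_const_or_inj_on_deg[of x y z w] xyz(4) w(2) by blast
qed

text \<open>
  A class of at most three vertices may be a monochromatic triangle. It still satisfies all three
  bounds, for trivial reasons, and so small classes need no separate treatment in what follows.
\<close>

lemma class_bounds:
  assumes "s \<in> V"
  shows "card (deg_class s) \<le> 5" "red_degree (deg_class s) r s \<le> 2"
    "card (deg_class s) \<le> red_degree (deg_class s) r s + 3"
proof -
  have s: "s \<in> deg_class s"
    using assms by (simp add: deg_class_def)
  have "card (deg_class s) \<le> 5 \<and> red_degree (deg_class s) r s \<le> 2 \<and>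
    card (deg_class s) \<le> red_degree (deg_class s) r s + 3"
  proof (cases "4 \<le> card (deg_class s)")
    case True
    then show ?thesis
      using triangle_free_on_red_degree[OF finite_deg_class large_class_triangle_free s]
        triangle_free_on_card_le_5[OF finite_deg_class large_class_triangle_free] by blast
  next
    case False
    then show ?thesis
      using red_degree_plus_blue_degree[OF finite_deg_class s, of r] by linarith
  qed
  then show "card (deg_class s) \<le> 5" "red_degree (deg_class s) r s \<le> 2"
    "card (deg_class s) \<le> red_degree (deg_class s) r s + 3"
    by blast+
qed

definition transversal :: "'a set \<Rightarrow> bool" where
  "transversal S \<longleftrightarrow> S \<subseteq> V \<and> inj_on deg S \<and> deg ` S = deg ` V"

lemma ex_transversal: "\<exists>S. transversal S"
proof -
  have "\<exists>S\<subseteq>V. inj_on deg S \<and> deg ` V = deg ` S"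
    by (rule iffD1[OF subset_image_inj subset_refl])
  then obtain S where "S \<subseteq> V" "inj_on deg S" "deg ` V = deg ` S"
    by blast
  then have "transversal S"
    by (simp add: transversal_def)
  then show ?thesis ..
qed

text \<open>
  Any fourth representative completes a monochromatic triangle of a transversal to a singular copy
  with four distinct degrees.
\<close>

lemma transversal_triangle_free:
  assumes "transversal S" "4 \<le> card S"
  shows "triangle_free_on S r"
  unfolding triangle_free_on_def
proof (intro ballI notI)
  fix x y z
  assume xyz: "x \<in> S" "y \<in> S" "z \<in> S" "mono_triangle r x y z"
  obtain w where w: "w \<in> S" "w \<notin> {x, y, z}"
    using obtain_fourth[OF assms(2)] .
  have S: "S \<subseteq> V" "inj_on deg S"
    using assms(1) by (simp_all add: transversal_def)
  have sub: "{x, y, z, w} \<subseteq> S"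
    using xyz w by simp
  have "const_or_inj_on deg {x, y, z, w}"
    unfolding const_or_inj_on_def using inj_on_subset[OF S(2) sub] by (rule disjI2)
  moreover have "{x, y, z, w} \<subseteq> V"
    using sub S(1) by (rule subset_trans)
  ultimately show False
    using not_const_or_inj_on_deg[of x y z w] xyz(4) w(2) by blast
qed

lemma finite_transversal: "transversal S \<Longrightarrow> finite S"
  using finite_subset[OF _ finite_V] by (simp add: transversal_def)

lemma UN_deg_class:
  assumes "transversal S"
  shows "(\<Union>s\<in>S. deg_class s) = V"
proof (intro equalityI subsetI)
  fix v assume "v \<in> V"
  then have "deg v \<in> deg ` S"
    using assms by (simp add: transversal_def)
  then obtain s where "s \<in> S" "deg v = deg s"
    by (rule imageE)
  then show "v \<in> (\<Union>s\<in>S. deg_class s)"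
    using \<open>v \<in> V\<close> by (auto simp: deg_class_def)
qed (auto simp: deg_class_def)

lemma deg_class_disjoint:
  assumes "transversal S" "s \<in> S" "t \<in> S" "s \<noteq> t"
  shows "deg_class s \<inter> deg_class t = {}"
  using assms unfolding transversal_def deg_class_def by (auto dest: inj_onD)

lemma sum_card_deg_class:
  assumes "transversal S"
  shows "(\<Sum>s\<in>S. card (deg_class s)) = card V"
  using card_UN_disjoint[of S deg_class] UN_deg_class[OF assms] finite_transversal[OF assms]
    finite_deg_class deg_class_disjoint[OF assms] by simp

lemma transversal_swap:
  assumes "transversal S" "s \<in> S" "u \<in> deg_class s"
  shows "transversal (insert u (S - {s}))"
proof -
  have u: "u \<in> V" "deg u = deg s"
    using assms(3) by (auto simp: deg_class_def)
  have S: "S \<subseteq> V" "inj_on deg S" "deg ` S = deg ` V"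
    using assms(1) by (auto simp: transversal_def)
  have "inj_on deg (insert u (S - {s}))"
    using S(2) u assms(2) by (auto simp: inj_on_def)
  moreover have "deg ` insert u (S - {s}) = deg ` S"
    using u assms(2) by auto
  ultimately show ?thesis
    using S u unfolding transversal_def by auto
qed

lemma card_transversal:
  assumes "transversal S" "16 \<le> card V"
  shows "4 \<le> card S" "card S \<le> 5"
proof -
  have "card V \<le> (\<Sum>s\<in>S. 5)"
    unfolding sum_card_deg_class[OF assms(1), symmetric]
    using assms(1) by (intro sum_mono class_bounds) (auto simp: transversal_def)
  then show *: "4 \<le> card S"
    using assms(2) by simp
  show "card S \<le> 5"
    by (rule triangle_free_on_card_le_5[OF finite_transversal transversal_triangle_free, OF assms(1,1) *])
qed

lemma red_degree_transversal:
  assumes "transversal S" "card S = 5" "s \<in> S"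
  shows "red_degree S r s = 2"
proof -
  have "triangle_free_on S r"
    using assms by (intro transversal_triangle_free) auto
  note bounds = triangle_free_on_red_degree[OF finite_transversal[OF assms(1)] this assms(3)]
  show ?thesis
    using bounds assms(2) by simp
qed

text \<open>
  Exchanging \<open>t\<close> for \<open>u\<close> in the transversal changes nothing at \<open>s\<close> except the color of one edge. As
  \<open>s\<close> has exactly two red neighbors before and after the exchange, that color stays the same.
\<close>

lemma color_constant_on_class:
  assumes S: "transversal S" "card S = 5" and st: "s \<in> S" "t \<in> S" "s \<noteq> t"
    and u: "u \<in> deg_class t"
  shows "r s u = r s t"
proof -
  let ?S' = "insert u (S - {t})"
  let ?N = "red_nbrs (S - {s, t}) r s"
  have S': "transversal ?S'"
    using transversal_swap S(1) st(2) u by blast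
  have "u \<notin> S - {t}"
    using S(1) u st unfolding transversal_def deg_class_def by (auto dest: inj_onD)
  then have "card ?S' = 5" and us: "u \<notin> S - {s, t}" "u \<noteq> s"
    using S st finite_transversal[OF S(1)] by auto
  then have eq: "red_degree S r s = red_degree ?S' r s"
    using red_degree_transversal S S' st by simp
  have fin: "finite ?N" and nin: "t \<notin> ?N" "u \<notin> ?N"
    using finite_transversal[OF S(1)] us by (auto simp: red_nbrs_def)
  have "red_nbrs S r s = (if r s t then insert t ?N else ?N)"
    "red_nbrs ?S' r s = (if r s u then insert u ?N else ?N)"
    using st us by (auto simp: red_nbrs_def)
  then show ?thesis
    using eq fin nin unfolding red_degree_def by (auto split: if_splits)
qed

lemma deg_transversal:
  assumes S: "transversal S" "card S = 5" "s \<in> S"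
  shows "deg s = red_degree (deg_class s) r s + (\<Sum>t\<in>red_nbrs S r s. card (deg_class t))"
proof -
  let ?N = "red_nbrs S r s"
  have "red_nbrs V r s = red_nbrs (deg_class s) r s \<union> (\<Union>t\<in>?N. deg_class t)"
  proof (intro equalityI subsetI)
    fix u assume u: "u \<in> red_nbrs V r s"
    then obtain t where t: "t \<in> S" "u \<in> deg_class t"
      using UN_deg_class[OF S(1)] by (auto simp: red_nbrs_def)
    show "u \<in> red_nbrs (deg_class s) r s \<union> (\<Union>t\<in>?N. deg_class t)"
      using u t color_constant_on_class[OF S(1,2,3) t(1) _ t(2)]
      by (cases "t = s") (auto simp: red_nbrs_def)
  next
    fix u assume "u \<in> red_nbrs (deg_class s) r s \<union> (\<Union>t\<in>?N. deg_class t)"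
    then show "u \<in> red_nbrs V r s"
    proof
      assume "u \<in> red_nbrs (deg_class s) r s"
      then show ?thesis
        by (auto simp: red_nbrs_def deg_class_def)
    next
      assume "u \<in> (\<Union>t\<in>?N. deg_class t)"
      then obtain t where t: "t \<in> S" "t \<noteq> s" "r s t" "u \<in> deg_class t"
        by (auto simp: red_nbrs_def)
      have "u \<noteq> s"
        using t S deg_class_disjoint[OF S(1,3) t(1)] by (auto simp: deg_class_def transversal_def)
      then show ?thesis
        using t color_constant_on_class[OF S(1,2,3) t(1) _ t(4)]
        by (auto simp: red_nbrs_def deg_class_def)
    qed
  qed
  moreover have "red_nbrs (deg_class s) r s \<inter> (\<Union>t\<in>?N. deg_class t) = {}"
    using deg_class_disjoint[OF S(1,3)] unfolding red_nbrs_def by blast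
  moreover have "card (\<Union>t\<in>?N. deg_class t) = (\<Sum>t\<in>?N. card (deg_class t))"
    using finite_transversal[OF S(1)] finite_deg_class deg_class_disjoint[OF S(1)]
    by (intro card_UN_disjoint) (auto simp: red_nbrs_def)
  moreover have "finite (red_nbrs (deg_class s) r s)" "finite (\<Union>t\<in>?N. deg_class t)"
    using finite_transversal[OF S(1)] finite_deg_class by (auto simp: red_nbrs_def)
  ultimately show ?thesis
    by (simp add: red_degree_def card_Un_disjoint)
qed

text \<open>Double counting: every \<open>t\<close> is a red neighbor of exactly two members of the transversal.\<close>

lemma sum_over_red_nbrs:
  assumes "transversal S" "card S = 5"
  shows "(\<Sum>s\<in>S. \<Sum>t\<in>red_nbrs S r s. f t) = 2 * (\<Sum>t\<in>S. f t :: nat)"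
proof -
  have fin: "finite S"
    using finite_transversal[OF assms(1)] .
  have "(\<Sum>s\<in>S. \<Sum>t\<in>red_nbrs S r s. f t) = (\<Sum>t\<in>S. \<Sum>s | s \<in> S \<and> t \<noteq> s \<and> r s t. f t)"
    unfolding red_nbrs_def by (rule sum.swap_restrict[OF fin fin])
  also have "\<dots> = (\<Sum>t\<in>S. red_degree S r t * f t)"
  proof (rule sum.cong[OF refl])
    fix t
    have "{s. s \<in> S \<and> t \<noteq> s \<and> r s t} = red_nbrs S r t"
      using sym_r by (auto simp: red_nbrs_def)
    then show "(\<Sum>s | s \<in> S \<and> t \<noteq> s \<and> r s t. f t) = red_degree S r t * f t"
      by (simp add: red_degree_def)
  qed
  also have "\<dots> = 2 * (\<Sum>t\<in>S. f t)"
    using red_degree_transversal[OF assms] by (simp add: sum_distrib_left)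
  finally show ?thesis .
qed

text \<open>
  The sum of the five distinct degrees is squeezed between \<open>3 m - 15\<close> and 50, where \<open>m\<close> is the number
  of vertices.
\<close>

theorem card_le_21: "card V \<le> 21"
proof (rule ccontr)
  assume "\<not> ?thesis"
  then have V: "22 \<le> card V"
    by simp
  obtain S where S: "transversal S"
    using ex_transversal by blast
  have SV: "S \<subseteq> V" and inj: "inj_on deg S"
    using S by (auto simp: transversal_def)
  have "card V \<le> (\<Sum>s\<in>S. 5)"
    unfolding sum_card_deg_class[OF S, symmetric]
    using SV by (intro sum_mono class_bounds) auto
  \<comment> \<open>Four classes would cover at most 20 vertices.\<close>
  then have card_S: "card S = 5"
    using V card_transversal[OF S] by simp
  have le_12: "deg s \<le> 12" if "s \<in> S" for s
  proof -
    have "(\<Sum>t\<in>red_nbrs S r s. card (deg_class t)) \<le> (\<Sum>t\<in>red_nbrs S r s. 5)"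
      using SV by (intro sum_mono class_bounds) (auto simp: red_nbrs_def)
    also have "\<dots> = 10"
      using red_degree_transversal[OF S card_S that] by (simp add: red_degree_def)
    finally show ?thesis
      using deg_transversal[OF S card_S that] class_bounds(2)[of s] SV that by auto
  qed
  have "\<Sum> (deg ` S) \<le> 50"
    using card_S le_12 by (intro sum_distinct_nat_le) (auto simp: card_image[OF inj])
  then have upper: "(\<Sum>s\<in>S. deg s) \<le> 50"
    using inj by (simp add: sum.reindex)
  \<comment> \<open>One copy of \<open>card V\<close> comes from the classes themselves, two from the red classes next to them.\<close>
  have "3 * card V = (\<Sum>s\<in>S. card (deg_class s)) + (\<Sum>s\<in>S. \<Sum>t\<in>red_nbrs S r s. card (deg_class t))"
    by (simp add: sum_over_red_nbrs[OF S card_S] sum_card_deg_class[OF S])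
  also have "\<dots> = (\<Sum>s\<in>S. card (deg_class s) + (\<Sum>t\<in>red_nbrs S r s. card (deg_class t)))"
    by (simp add: sum.distrib)
  also have "\<dots> \<le> (\<Sum>s\<in>S. deg s + 3)"
  proof (intro sum_mono)
    fix s assume "s \<in> S"
    then show "card (deg_class s) + (\<Sum>t\<in>red_nbrs S r s. card (deg_class t)) \<le> deg s + 3"
      using deg_transversal[OF S card_S, of s] class_bounds(3)[of s] SV by auto
  qed
  also have "\<dots> = (\<Sum>s\<in>S. deg s) + 15"
    using card_S by (simp add: sum.distrib)
  finally show False
    using V upper by simp
qed

end

corollary has_singular_if_card_ge_22:
  assumes "finite V" "\<And>u v. r u v = r v u" "22 \<le> card V"
  shows "has_singular V r"
proof (rule ccontr)
  assume "\<not> has_singular V r"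
  then interpret singular_free_coloring V r
    using assms by unfold_locales
  show False
    using card_le_21 assms(3) by simp
qed

section \<open>A singular-free coloring on 21 vertices\<close>

definition pentagon :: "nat \<Rightarrow> nat \<Rightarrow> bool" where
  "pentagon i j \<longleftrightarrow> j = (i + 1) mod 5 \<or> i = (j + 1) mod 5"

text \<open>
  The classes are \<open>{0..4}\<close>, \<open>{5..9}\<close>, \<open>{10..14}\<close>, \<open>{15, 16}\<close> and \<open>{17..20}\<close>, numbered along the red
  pentagon. In the first three, residues modulo 5 enumerate the class.
\<close>

definition part :: "nat \<Rightarrow> nat" where
  "part v = (if v < 15 then v div 5 else if v < 17 then 3 else 4)"

definition blowup :: "nat \<Rightarrow> nat \<Rightarrow> bool" where
  "blowup u v \<longleftrightarrow>
     (if part u \<noteq> part v then pentagon (part u) (part v)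
      else if part u \<le> 2 then pentagon (u mod 5) (v mod 5)
      else {u, v} \<in> {{15, 16}, {17, 18}, {19, 20}})"

lemma blowup_sym: "blowup u v = blowup v u"
  by (auto simp: blowup_def pentagon_def insert_commute)

lemma pentagon_triangle_free: "triangle_free_on {..<5} pentagon"
proof -
  have "\<forall>x\<in>{0,1,2,3,4}. \<forall>y\<in>{0,1,2,3,4}. \<forall>z\<in>{0,1,2,3,4}. \<not> mono_triangle pentagon x y z"
    by (simp add: mono_triangle_def pentagon_def)
  moreover have "{..<5::nat} = {0,1,2,3,4}"
    by auto
  ultimately show ?thesis
    by (simp add: triangle_free_on_def)
qed

lemma no_mono_triangle_rainbow:
  assumes "inj_on part {x, y, z}"
  shows "\<not> mono_triangle blowup x y z"
proof
  assume t: "mono_triangle blowup x y z"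
  then have "mono_triangle pentagon (part x) (part y) (part z)"
    using assms by (auto simp: mono_triangle_def blowup_def inj_on_def)
  moreover have "part v \<in> {..<5}" for v
    by (auto simp: part_def)
  ultimately show False
    using pentagon_triangle_free unfolding triangle_free_on_def by blast
qed

lemma no_mono_triangle_in_part:
  assumes "x < 21" "part x = part y" "part y = part z" "y < 21" "z < 21"
  shows "\<not> mono_triangle blowup x y z"
proof (cases "part x \<le> 2")
  case True
  show ?thesis
  proof
    assume t: "mono_triangle blowup x y z"
    have "x < 15" "y < 15" "z < 15" and div: "x div 5 = y div 5" "y div 5 = z div 5"
      using True assms by (auto simp: part_def split: if_splits)
    have inj: "u mod 5 = v mod 5 \<longleftrightarrow> u = v" if "u div 5 = v div 5" for u v :: nat
      using that by (metis div_mult_mod_eq)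
    have "mono_triangle pentagon (x mod 5) (y mod 5) (z mod 5)"
      using t True assms(2,3) inj div by (auto simp: mono_triangle_def blowup_def)
    then show False
      using pentagon_triangle_free unfolding triangle_free_on_def by force
  qed
next
  case False
  show ?thesis
  proof (cases "x < 17")
    case True
    then have "{x, y, z} \<subseteq> {15, 16}"
      using assms False by (auto simp: part_def split: if_splits)
    then show ?thesis
      by (auto simp: mono_triangle_def)
  next
    case False
    then have "x \<in> {17, 18, 19, 20}" "y \<in> {17, 18, 19, 20}" "z \<in> {17, 18, 19, 20}"
      using assms by (auto simp: part_def split: if_splits)
    then show ?thesis
      by (elim insertE emptyE)
        (simp_all add: mono_triangle_def blowup_def part_def doubleton_eq_iff)
  qed
qed

text \<open>
  For instance, the degree in the first class is \<open>5 + 4 + 2\<close>: its red neighbors along the pentagon are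
  the classes of sizes 5 and 4. All 21 degrees are found by evaluation.
\<close>

lemma red_degree_blowup:
  assumes "v < 21"
  shows "red_degree {..<21} blowup v = [11, 12, 9, 10, 8] ! part v"
proof -
  have "red_nbrs {..<21} blowup v = set (filter (\<lambda>u. u \<noteq> v \<and> blowup v u) [0..<21])"
    by (auto simp: red_nbrs_def)
  then have "red_degree {..<21} blowup v = length (filter (\<lambda>u. u \<noteq> v \<and> blowup v u) [0..<21])"
    by (simp only: red_degree_def distinct_card distinct_filter distinct_upt)
  moreover have "\<forall>v\<in>set [0..<21].
    length (filter (\<lambda>u. u \<noteq> v \<and> blowup v u) [0..<21]) = [11, 12, 9, 10, 8] ! part v"
    by code_simp
  ultimately show ?thesis
    using assms by simp
qed

lemma red_degree_blowup_eq_iff: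
  assumes "u < 21" "v < 21"
  shows "red_degree {..<21} blowup u = red_degree {..<21} blowup v \<longleftrightarrow> part u = part v"
proof -
  have "distinct [11, 12, 9, 10, 8::nat]" "part u < 5" "part v < 5"
    by (auto simp: part_def)
  then show ?thesis
    using nth_eq_iff_index_eq[of "[11, 12, 9, 10, 8::nat]" "part u" "part v"]
    by (simp add: red_degree_blowup assms)
qed

lemma not_has_singular_blowup: "\<not> has_singular {..<21} blowup"
proof
  assume "has_singular {..<21} blowup"
  then obtain x y z w where lt: "x < 21" "y < 21" "z < 21" "w < 21"
    and t: "mono_triangle blowup x y z"
    and deg: "const_or_inj_on (red_degree {..<21} blowup) {x, y, z, w}"
    unfolding has_singular_def by blast
  have "const_or_inj_on part {x, y, z, w}"
    using deg lt const_or_inj_on_cong[of "{x, y, z, w}" "red_degree {..<21} blowup" part]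
      red_degree_blowup_eq_iff by auto
  then consider "part x = part y" "part y = part z" | "inj_on part {x, y, z, w}"
    unfolding const_or_inj_on_def by auto
  then show False
  proof cases
    case 1
    then show False
      using no_mono_triangle_in_part lt t by blast
  next
    case 2
    then have "inj_on part {x, y, z}"
      by (rule inj_on_subset) auto
    then show False
      using no_mono_triangle_rainbow t by blast
  qed
qed

text \<open>
  Colorings of \<open>K\<^sub>m\<close> are functions of the edge as a set; by symmetry, the order in which the two
  endpoints are extracted is irrelevant.
\<close>

definition blowup_edge_color :: "nat set \<Rightarrow> bool" where
  "blowup_edge_color e = blowup (Min e) (Max e)"

lemma blowup_edge_color: "blowup_edge_color {u, v} = blowup u v"
  using blowup_sym by (auto simp: blowup_edge_color_def min_def max_def)

section \<open>The singular Ramsey number\<close>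

text \<open>
  One coloring refutes every smaller threshold: if \<open>N \<le> 21\<close>, then \<open>m = 21\<close> is among the sizes
  \<open>m \<ge> N\<close> that \<open>N\<close> would have to cover.
\<close>

theorem theorem34:
  shows "Rs (disjoint_union (complete_graph 3) (complete_graph 1)) = 22"
  unfolding Rs_def singular_K3_K1_iff_has_singular
proof (rule Least_equality)
  show "\<forall>m\<ge>22::nat. \<forall>c. has_singular {..<m} (\<lambda>u v. c {u, v})"
    by (auto intro!: has_singular_if_card_ge_22 simp: insert_commute)
next
  fix N :: nat
  assume N: "\<forall>m\<ge>N. \<forall>c. has_singular {..<m} (\<lambda>u v. c {u, v})"
  show "22 \<le> N"
  proof (rule ccontr)
    assume "\<not> 22 \<le> N"
    then have "has_singular {..<21} (\<lambda>u v. blowup_edge_color {u, v})"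
      using N[rule_format, of 21] by simp
    then show False
      using not_has_singular_blowup by (simp add: blowup_edge_color)
  qed
qed

end
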